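(* Let $F$ be a non-archimedean ordered field, $\mathcal{C}$ the set of all convex subgroups of $(F,+)$, and $Q=\{a+A: a\in F, A\in\mathcal{C}\}$ with operations $(a+A)+(b+B)=a+b+A+B$, $(a+A)(b+B)=ab+aB+bA+AB$, and order $\alpha\le\beta$ iff $(\forall x\in\alpha)(\exists y\in\beta)(x\le y)$. Then $(Q,+,\cdot,\le)$ is a solid (with $e(a+A)=A$, $s(a+A)=-a+A$, and for $\alpha=a+A\notin\mathcal{C}$, $u(\alpha)=1+A/a$, $d(\alpha)=\frac1a+\frac{A}{a^2}$).
   Context: A subset of $F$ is convex if it contains every element lying between two of its elements; sums/products of sets are elementwise, and the operations on $Q$ are independent of representatives. Write $x<y$ iff $x\le y$ and $x\ne y$. Assembly: a non-empty structure $(\mathcal{A},\ast)$ such that (1) $\ast$ is associative; (2) commutative; (3) for every $x$ there is $e$ with $x\ast e=x$ and such that $x\ast f=x$ implies $e\ast f=e$ (unique, denoted $e(x)$); (4) for every $x$ there is $s$ with $x\ast s=e(x)$ and $e(s)=e(x)$ (unique, denoted $s(x)$); (5) for all $x,y$, $e(x\ast y)=e(x)$ or $e(x\ast y)=e(y)$. Association: $(\mathcal{A},+,\cdot)$ with $(\mathcal{A},+)$ an assembly (operators $e,s$), $\mathcal{N}=\{x:x=e(x)\}$, $(\mathcal{A}\setminus\mathcal{N},\cdot)$ an assembly (operators $u,d$), and for all $x,y,z$: (1) $xy+xz=x(y+z)+e(x)y+e(x)z$; (2) $\exists w\,(e(x)y=e(w))$; (3) $e(xy)=e(x)y+e(y)x$;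 (4) if $x\ne e(x)$ then $e(u(x))=e(x)d(x)$; (5) $s(xy)=s(x)y$. Ordered association: an association with a total order $\le$ such that for all $x,y,z$: (1) $x\le y\Rightarrow x+z\le y+z$; (2) $y+e(x)=e(x)\Rightarrow (y\le e(x)\wedge s(y)\le e(x))$; (3) $(e(x)<x\wedge y\le z)\Rightarrow xy\le xz$; (4) $(e(y)\le y\le z)\Rightarrow e(x)y\le e(x)z$. Solid: an ordered association $(S,+,\cdot,\le)$ such that (1) there is $m$ with $m+x=x$ for all $x$; (2) there is $M$ with $e(x)+M=M$ for all $x$; (3) there is $u_0$ with $u_0x=x$ for all $x$; (4) for every $x$ there is $a$ with $x=a+e(x)$ and $e(a)=m$; (5) there is $x$ with $e(x)\ne m$ and $e(x)\ne M$; (6) for all $x,y$ with $x=e(x)$, $y=e(y)$ and $x<y$ there is $z$ with $z\ne e(z)$ and $x<z<y$. *)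

theory Defs
  imports Main "HOL-Library.Set_Algebras"
begin

definition is_neutral :: "'a set \<Rightarrow> ('a \<Rightarrow> 'a \<Rightarrow> 'a) \<Rightarrow> 'a \<Rightarrow> 'a \<Rightarrow> bool" where
  "is_neutral A f x e \<longleftrightarrow> e \<in> A \<and> f x e = x \<and> (\<forall>g\<in>A. f x g = x \<longrightarrow> f e g = e)"

definition neutral :: "'a set \<Rightarrow> ('a \<Rightarrow> 'a \<Rightarrow> 'a) \<Rightarrow> 'a \<Rightarrow> 'a" where
  "neutral A f x = (THE e. is_neutral A f x e)"

definition is_symmetric :: "'a set \<Rightarrow> ('a \<Rightarrow> 'a \<Rightarrow> 'a) \<Rightarrow> 'a \<Rightarrow> 'a \<Rightarrow> bool" where
  "is_symmetric A f x s \<longleftrightarrow> s \<in> A \<and> f x s = neutral A f x \<and> neutral A f s = neutral A f x"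

definition symmetric :: "'a set \<Rightarrow> ('a \<Rightarrow> 'a \<Rightarrow> 'a) \<Rightarrow> 'a \<Rightarrow> 'a" where
  "symmetric A f x = (THE s. is_symmetric A f x s)"

locale assembly =
  fixes A :: "'a set" and f :: "'a \<Rightarrow> 'a \<Rightarrow> 'a"  (infixl "\<star>" 70)
  assumes nonempty: "A \<noteq> {}"
    and closed: "\<lbrakk>x \<in> A; y \<in> A\<rbrakk> \<Longrightarrow> x \<star> y \<in> A"
    and assoc: "\<lbrakk>x \<in> A; y \<in> A; z \<in> A\<rbrakk> \<Longrightarrow> (x \<star> y) \<star> z = x \<star> (y \<star> z)"
    and commute: "\<lbrakk>x \<in> A; y \<in> A\<rbrakk> \<Longrightarrow> x \<star> y = y \<star> x"
    and ex_neutral: "x \<in> A \<Longrightarrow> \<exists>e. is_neutral A f x e"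
    and ex_symmetric: "x \<in> A \<Longrightarrow> \<exists>s. is_symmetric A f x s"
    and neutral_op: "\<lbrakk>x \<in> A; y \<in> A\<rbrakk> \<Longrightarrow>
      neutral A f (x \<star> y) = neutral A f x \<or> neutral A f (x \<star> y) = neutral A f y"
begin

lemma neutral_unique:
  assumes "x \<in> A" "is_neutral A f x e" "is_neutral A f x e'"
  shows "e = e'"
  using assms commute[of e e'] unfolding is_neutral_def by metis

lemma is_neutral_neutral: "x \<in> A \<Longrightarrow> is_neutral A f x (neutral A f x)"
  unfolding neutral_def using ex_neutral neutral_unique by (metis theI')

lemma symmetric_unique:
  assumes x: "x \<in> A" and s: "is_symmetric A f x s" and t: "is_symmetric A f x t"
  shows "s = t"
proof -
  let ?e = "neutral A f x"
  have A: "s \<in> A" "t \<in> A" "?e \<in> A"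
    using s t is_neutral_neutral[OF x] by (auto simp: is_symmetric_def is_neutral_def)
  have xs: "x \<star> s = ?e" "x \<star> t = ?e"
    using s t by (simp_all add: is_symmetric_def)
  have se: "s \<star> ?e = s" "t \<star> ?e = t"
    using s t is_neutral_neutral[of s] is_neutral_neutral[of t]
    by (auto simp: is_symmetric_def is_neutral_def)
  have "s = s \<star> (x \<star> t)" by (simp only: xs se)
  also have "\<dots> = (s \<star> x) \<star> t" by (rule assoc[OF A(1) x A(2), symmetric])
  also have "\<dots> = ?e \<star> t" by (simp only: commute[OF A(1) x] xs)
  also have "\<dots> = t" by (simp only: commute[OF A(3) A(2)] se)
  finally show ?thesis .
qed

lemma is_symmetric_symmetric: "x \<in> A \<Longrightarrow> is_symmetric A f x (symmetric A f x)"
  unfolding symmetric_def using ex_symmetric symmetric_unique by (metis theI')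

end

definition zeroless :: "'a set \<Rightarrow> ('a \<Rightarrow> 'a \<Rightarrow> 'a) \<Rightarrow> 'a set" where
  "zeroless S add = S - {x \<in> S. x = neutral S add x}"

locale two_operations =
  fixes S :: "'a set"
    and add :: "'a \<Rightarrow> 'a \<Rightarrow> 'a"  (infixl "\<oplus>" 65)
    and mul :: "'a \<Rightarrow> 'a \<Rightarrow> 'a"  (infixl "\<odot>" 70)
begin

abbreviation e :: "'a \<Rightarrow> 'a" where "e \<equiv> neutral S add"
abbreviation s :: "'a \<Rightarrow> 'a" where "s \<equiv> symmetric S add"
abbreviation u :: "'a \<Rightarrow> 'a" where "u \<equiv> neutral (zeroless S add) mul"
abbreviation d :: "'a \<Rightarrow> 'a" where "d \<equiv> symmetric (zeroless S add) mul"

end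

locale association = two_operations +
  assumes additive: "assembly S add"
    and mul_closed: "\<lbrakk>x \<in> S; y \<in> S\<rbrakk> \<Longrightarrow> x \<odot> y \<in> S"
    and multiplicative: "assembly (zeroless S add) mul"
    and distrib: "\<lbrakk>x \<in> S; y \<in> S; z \<in> S\<rbrakk> \<Longrightarrow>
      x \<odot> y \<oplus> x \<odot> z = x \<odot> (y \<oplus> z) \<oplus> e x \<odot> y \<oplus> e x \<odot> z"
    and neutral_mul: "\<lbrakk>x \<in> S; y \<in> S\<rbrakk> \<Longrightarrow> \<exists>w\<in>S. e x \<odot> y = e w"
    and neutral_of_mul: "\<lbrakk>x \<in> S; y \<in> S\<rbrakk> \<Longrightarrow> e (x \<odot> y) = e x \<odot> y \<oplus> e y \<odot> x"
    and neutral_unity: "\<lbrakk>x \<in> S; x \<noteq> e x\<rbrakk> \<Longrightarrow> e (u x) = e x \<odot> d x"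
    and symmetric_mul: "\<lbrakk>x \<in> S; y \<in> S\<rbrakk> \<Longrightarrow> s (x \<odot> y) = s x \<odot> y"

locale ordered_association = association +
  fixes le :: "'a \<Rightarrow> 'a \<Rightarrow> bool"  (infix "\<preceq>" 50)
  assumes total_order: "linear_order_on S {(x, y) \<in> S \<times> S. x \<preceq> y}"
    and add_mono: "\<lbrakk>x \<in> S; y \<in> S; z \<in> S; x \<preceq> y\<rbrakk> \<Longrightarrow> x \<oplus> z \<preceq> y \<oplus> z"
    and absorbed_le: "\<lbrakk>x \<in> S; y \<in> S; y \<oplus> e x = e x\<rbrakk> \<Longrightarrow> y \<preceq> e x \<and> s y \<preceq> e x"
    and mul_mono: "\<lbrakk>x \<in> S; y \<in> S; z \<in> S; e x \<preceq> x; e x \<noteq> x; y \<preceq> z\<rbrakk> \<Longrightarrow> x \<odot> y \<preceq> x \<odot> z"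
    and neutral_mul_mono: "\<lbrakk>x \<in> S; y \<in> S; z \<in> S; e y \<preceq> y; y \<preceq> z\<rbrakk> \<Longrightarrow> e x \<odot> y \<preceq> e x \<odot> z"
begin

abbreviation lt :: "'a \<Rightarrow> 'a \<Rightarrow> bool"  (infix "\<prec>" 50) where
  "x \<prec> y \<equiv> x \<preceq> y \<and> x \<noteq> y"

end

locale solid = ordered_association +
  assumes ex_bounds: "\<exists>m\<in>S. \<exists>M\<in>S.
        (\<forall>x\<in>S. m \<oplus> x = x)
      \<and> (\<forall>x\<in>S. e x \<oplus> M = M)
      \<and> (\<forall>x\<in>S. \<exists>a\<in>S. x = a \<oplus> e x \<and> e a = m)
      \<and> (\<exists>x\<in>S. e x \<noteq> m \<and> e x \<noteq> M)"
    and ex_one: "\<exists>u0\<in>S. \<forall>x\<in>S. u0 \<odot> x = x"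
    and separation: "\<lbrakk>x \<in> S; y \<in> S; x = e x; y = e y; x \<prec> y\<rbrakk> \<Longrightarrow>
      \<exists>z\<in>S. z \<noteq> e z \<and> x \<prec> z \<and> z \<prec> y"

definition convex_subgroup :: "'a::linordered_field set \<Rightarrow> bool" where
  "convex_subgroup A \<longleftrightarrow>
     0 \<in> A \<and> (\<forall>x\<in>A. \<forall>y\<in>A. x + y \<in> A) \<and> (\<forall>x\<in>A. - x \<in> A)
   \<and> (\<forall>x\<in>A. \<forall>y\<in>A. \<forall>z. x \<le> z \<and> z \<le> y \<longrightarrow> z \<in> A)"

definition Q :: "'a::linordered_field set set" where
  "Q = {a +o A | a A. convex_subgroup A}"

text \<open>The operations are given on representatives; \<open>Q_add_coset\<close> and \<open>Q_mult_coset\<close>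
  below show that the choice of representatives does not matter.\<close>

definition Q_add :: "'a::linordered_field set \<Rightarrow> 'a set \<Rightarrow> 'a set" where
  "Q_add \<alpha> \<beta> = (THE \<gamma>. \<exists>a A b B. convex_subgroup A \<and> convex_subgroup B \<and>
     \<alpha> = a +o A \<and> \<beta> = b +o B \<and> \<gamma> = (a + b) +o (A + B))"

definition Q_mult :: "'a::linordered_field set \<Rightarrow> 'a set \<Rightarrow> 'a set" where
  "Q_mult \<alpha> \<beta> = (THE \<gamma>. \<exists>a A b B. convex_subgroup A \<and> convex_subgroup B \<and>
     \<alpha> = a +o A \<and> \<beta> = b +o B \<and> \<gamma> = (a * b) +o (a *o B + b *o A + A * B))"

definition Q_le :: "'a::linordered_field set \<Rightarrow> 'a set \<Rightarrow> bool" where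
  "Q_le \<alpha> \<beta> \<longleftrightarrow> (\<forall>x\<in>\<alpha>. \<exists>y\<in>\<beta>. x \<le> y)"

lemma convex_subgroup_zero: "convex_subgroup A \<Longrightarrow> 0 \<in> A"
  and convex_subgroup_add: "\<lbrakk>convex_subgroup A; x \<in> A; y \<in> A\<rbrakk> \<Longrightarrow> x + y \<in> A"
  and convex_subgroup_uminus: "\<lbrakk>convex_subgroup A; x \<in> A\<rbrakk> \<Longrightarrow> - x \<in> A"
  unfolding convex_subgroup_def by blast+

lemma coset_eqD:
  assumes A: "convex_subgroup A" and B: "convex_subgroup B" and eq: "a +o A = b +o B"
  shows "A = B" and "b - a \<in> A"
proof -
  have mem: "x \<in> c +o C \<longleftrightarrow> x - c \<in> C" for x c :: 'a and C
    by (force simp: elt_set_plus_def)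
  have iff: "x - a \<in> A \<longleftrightarrow> x - b \<in> B" for x
    using eq mem by metis
  have ba: "b - a \<in> A" using iff[of b] convex_subgroup_zero[OF B] by simp
  then have ab: "- (b - a) \<in> A" using convex_subgroup_uminus[OF A] by blast
  have "x \<in> B \<longleftrightarrow> x \<in> A" for x
  proof -
    have "x \<in> B \<longleftrightarrow> x + (b - a) \<in> A" using iff[of "x + b"] by (simp add: algebra_simps)
    also have "\<dots> \<longleftrightarrow> x \<in> A"
    proof
      assume "x + (b - a) \<in> A"
      then have "(x + (b - a)) + - (b - a) \<in> A"
        using convex_subgroup_add[OF A _ ab] by blast
      then show "x \<in> A" by simp
    qed (rule convex_subgroup_add[OF A _ ba])
    finally show ?thesis .
  qed
  then show "A = B" by blast
  show "b - a \<in> A" by (rule ba)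
qed

lemma Q_add_coset:
  assumes "convex_subgroup A" "convex_subgroup B"
  shows "Q_add (a +o A) (b +o B) = (a + b) +o (A + B)"
  unfolding Q_add_def
proof (rule the_equality)
  fix \<gamma>
  assume "\<exists>a' A' b' B'. convex_subgroup A' \<and> convex_subgroup B' \<and>
     a +o A = a' +o A' \<and> b +o B = b' +o B' \<and> \<gamma> = (a' + b') +o (A' + B')"
  then show "\<gamma> = (a + b) +o (A + B)"
    by (elim exE conjE) (simp flip: set_plus_rearrange)
qed (intro exI conjI, (rule assms refl)+)

lemma convex_subgroup_abs:
  assumes A: "convex_subgroup A" and x: "x \<in> A" and "\<bar>y\<bar> \<le> \<bar>x\<bar>"
  shows "y \<in> A"
proof -
  have "\<bar>x\<bar> \<in> A" "- \<bar>x\<bar> \<in> A"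
    using x convex_subgroup_uminus[OF A x] by (simp_all add: abs_if)
  moreover have "- \<bar>x\<bar> \<le> y" "y \<le> \<bar>x\<bar>" using assms(3) by linarith+
  ultimately show ?thesis using A unfolding convex_subgroup_def by blast
qed

lemma times_closed_add:
  fixes A B :: "'a::linordered_field set"
  assumes A: "convex_subgroup A" and B: "convex_subgroup B"
    and "v \<in> A * B" "w \<in> A * B"
  shows "v + w \<in> A * B"
proof -
  obtain a b x y where v: "v = a * b" "a \<in> A" "b \<in> B" and w: "w = x * y" "x \<in> A" "y \<in> B"
    using assms by (auto elim!: set_times_elim)
  define p where "p = max \<bar>a\<bar> \<bar>x\<bar>"
  define q where "q = max \<bar>b\<bar> \<bar>y\<bar>"
  have "\<bar>a\<bar> \<in> A" "\<bar>x\<bar> \<in> A" "\<bar>b\<bar> \<in> B" "\<bar>y\<bar> \<in> B"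
    by (rule convex_subgroup_abs[OF A v(2)] convex_subgroup_abs[OF A w(2)]
        convex_subgroup_abs[OF B v(3)] convex_subgroup_abs[OF B w(3)], simp)+
  then have pA: "p \<in> A" and qB: "q \<in> B"
    by (simp_all add: p_def q_def max_def)
  have ppA: "p + p \<in> A" using convex_subgroup_add[OF A pA pA] .
  have p0: "0 \<le> p" and q0: "0 \<le> q" by (auto simp: p_def q_def)
  have "\<bar>a * b\<bar> \<le> p * q" "\<bar>x * y\<bar> \<le> p * q"
    unfolding abs_mult by (intro mult_mono; auto simp: p_def q_def)+
  then have le: "\<bar>v + w\<bar> \<le> (p + p) * q"
    using abs_triangle_ineq[of v w] by (simp add: v w distrib_right)
  show ?thesis
  proof (cases "q = 0")
    case True
    then have "v + w = p * q" using le by simp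
    then show ?thesis using pA qB by (simp add: set_times_intro)
  next
    case False
    then have "\<bar>(v + w) / q\<bar> \<le> \<bar>p + p\<bar>"
      using le p0 q0 by (simp add: divide_simps abs_divide)
    then have "(v + w) / q \<in> A" using convex_subgroup_abs[OF A ppA] by blast
    then have "(v + w) / q * q \<in> A * B" using qB by (rule set_times_intro)
    then show ?thesis using False by simp
  qed
qed

lemma Q_mult_coset_subset:
  fixes A B :: "'a::linordered_field set"
  assumes A: "convex_subgroup A" and B: "convex_subgroup B"
    and x: "a' - a \<in> A" and y: "b' - b \<in> B"
  shows "(a' * b') +o (a' *o B + b' *o A + A * B) \<subseteq> (a * b) +o (a *o B + b *o A + A * B)"
proof
  fix t assume "t \<in> (a' * b') +o (a' *o B + b' *o A + A * B)"
  then obtain p q r where t: "t = a' * b' + (a' * p + b' * q + r)"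
    and p: "p \<in> B" and q: "q \<in> A" and r: "r \<in> A * B"
    by (auto simp: elt_set_plus_def elt_set_times_def elim!: set_plus_elim)
  define x y where "x = a' - a" and "y = b' - b"
  have xy: "x \<in> A" "y \<in> B" using assms by (auto simp: x_def y_def)
  have "x * y + x * p \<in> A * B" "q * y + r \<in> A * B"
    using xy p q r by (auto intro!: times_closed_add[OF A B] set_times_intro)
  then have r': "(x * y + x * p) + (q * y + r) \<in> A * B" (is "?r \<in> _")
    by (rule times_closed_add[OF A B])
  have "y + p \<in> B" "x + q \<in> A" using convex_subgroup_add[OF B xy(2) p] convex_subgroup_add[OF A xy(1) q] .
  then have "a * (y + p) + b * (x + q) + ?r \<in> a *o B + b *o A + A * B"
    using r' by (intro set_plus_intro set_times_intro2)
  moreover have "t = a * b + (a * (y + p) + b * (x + q) + ?r)"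
    unfolding t x_def y_def by (simp add: algebra_simps)
  ultimately show "t \<in> (a * b) +o (a *o B + b *o A + A * B)"
    by (simp add: set_plus_intro2)
qed

lemma Q_mult_coset:
  assumes "convex_subgroup A" "convex_subgroup B"
  shows "Q_mult (a +o A) (b +o B) = (a * b) +o (a *o B + b *o A + A * B)"
  unfolding Q_mult_def
proof (rule the_equality)
  fix \<gamma>
  assume "\<exists>a' A' b' B'. convex_subgroup A' \<and> convex_subgroup B' \<and>
     a +o A = a' +o A' \<and> b +o B = b' +o B' \<and> \<gamma> = (a' * b') +o (a' *o B' + b' *o A' + A' * B')"
  then obtain a' A' b' B' where *: "convex_subgroup A'" "convex_subgroup B'"
      "a +o A = a' +o A'" "b +o B = b' +o B'"
    and \<gamma>: "\<gamma> = (a' * b') +o (a' *o B' + b' *o A' + A' * B')" by blast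
  have [simp]: "A' = A" "B' = B"
    using coset_eqD(1)[OF assms(1) *(1,3)] coset_eqD(1)[OF assms(2) *(2,4)] by simp_all
  have "a' - a \<in> A" "b' - b \<in> B" "a - a' \<in> A" "b - b' \<in> B"
    using coset_eqD(2)[OF assms(1) *(1,3)] coset_eqD(2)[OF assms(2) *(2,4)]
      coset_eqD(2)[OF *(1) assms(1) *(3)[symmetric]] coset_eqD(2)[OF *(2) assms(2) *(4)[symmetric]]
    by simp_all
  then show "\<gamma> = (a * b) +o (a *o B + b *o A + A * B)"
    unfolding \<gamma> by (simp, intro subset_antisym Q_mult_coset_subset assms)
qed (intro exI conjI, (rule assms refl)+)

end

theory Submission imports Defs begin

text \<open>Convex subgroups of \<open>F\<close> form a chain under inclusion, so a sum of two of them is simply the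
  larger one; hence elementwise multiplication distributes over sums of convex subgroups, and the
  algebraic axioms reduce to identities in an idempotent semiring. If \<open>a \<notin> A\<close> then \<open>\<bar>a\<bar>\<close> exceeds every
  element of \<open>A\<close>, so \<open>AB \<subseteq> aB\<close>: the quadratic term drops out of products of zeroless cosets, and
  dividing by representatives yields unities and inverses. Non-archimedeanity supplies a convex
  subgroup other than \<open>{0}\<close> and \<open>F\<close>, namely the limited elements.\<close>

section \<open>Cosets and the chain of convex subgroups\<close>

lemma mem_coset_iff: "x \<in> c +o C \<longleftrightarrow> x - c \<in> C" for x c :: "'a::ab_group_add"
  by (force simp: elt_set_plus_def)

lemma convex_subgroup_diff: "\<lbrakk>convex_subgroup A; x \<in> A; y \<in> A\<rbrakk> \<Longrightarrow> x - y \<in> A"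
  using convex_subgroup_add[of A x "- y"] convex_subgroup_uminus[of A y] by simp

text \<open>Closure under smaller absolute value covers negation and convexity at once, since an
  element between two others is bounded in absolute value by one of them.\<close>

lemma convex_subgroupI:
  assumes "0 \<in> A" "\<And>x y. \<lbrakk>x \<in> A; y \<in> A\<rbrakk> \<Longrightarrow> x + y \<in> A"
    and abs: "\<And>x y. \<lbrakk>x \<in> A; \<bar>y\<bar> \<le> \<bar>x\<bar>\<rbrakk> \<Longrightarrow> y \<in> A"
  shows "convex_subgroup A"
  unfolding convex_subgroup_def
proof (intro conjI ballI allI impI)
  fix x y z assume "x \<in> A" "y \<in> A" "x \<le> z \<and> z \<le> y"
  then have "\<bar>z\<bar> \<le> \<bar>x\<bar> \<or> \<bar>z\<bar> \<le> \<bar>y\<bar>" by linarith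
  with \<open>x \<in> A\<close> \<open>y \<in> A\<close> show "z \<in> A" using abs by blast
qed (use assms in auto)

lemma coset_eq_iff:
  assumes "convex_subgroup A" "convex_subgroup B"
  shows "a +o A = b +o B \<longleftrightarrow> A = B \<and> b - a \<in> A"
proof
  assume "a +o A = b +o B"
  then show "A = B \<and> b - a \<in> A" using coset_eqD[OF assms] by blast
next
  assume *: "A = B \<and> b - a \<in> A"
  have "x - a \<in> A \<longleftrightarrow> x - b \<in> A" for x
    using convex_subgroup_add[OF assms(1), of "x - b" "b - a"]
      convex_subgroup_diff[OF assms(1), of "x - a" "b - a"] * by auto
  then show "a +o A = b +o B" using * by (auto simp: mem_coset_iff)
qed

lemma coset_self: "\<lbrakk>convex_subgroup A; a \<in> A\<rbrakk> \<Longrightarrow> a +o A = A"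
  using coset_eq_iff[of A A a 0] convex_subgroup_uminus by simp

text \<open>A subgroup contains 0, and 0 lies in \<open>a +o A\<close> only if \<open>- a\<close>
  lies in \<open>A\<close>. This translates the condition that a coset is not a convex subgroup into
  \<open>a \<notin> A\<close>, the form in which unities and inverses are computed.\<close>

lemma convex_subgroup_coset_iff:
  assumes "convex_subgroup A" shows "convex_subgroup (a +o A) \<longleftrightarrow> a \<in> A"
proof
  assume "convex_subgroup (a +o A)"
  then have "0 \<in> a +o A" by (rule convex_subgroup_zero)
  then show "a \<in> A" using convex_subgroup_uminus[OF assms, of "- a"] by (simp add: mem_coset_iff)
qed (use assms in \<open>simp add: coset_self\<close>)

lemma convex_subgroup_bound:
  assumes "convex_subgroup A" "a \<notin> A" "x \<in> A" shows "\<bar>x\<bar> < \<bar>a\<bar>"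
  using convex_subgroup_abs[OF assms(1,3), of a] assms(2) by linarith

text \<open>An element of \<open>A - B\<close> and an element of \<open>B - A\<close> would each be
  strictly smaller than the other in absolute value.\<close>

lemma convex_subgroup_chain:
  assumes "convex_subgroup A" "convex_subgroup B" shows "A \<subseteq> B \<or> B \<subseteq> A"
proof (rule ccontr)
  assume "\<not> ?thesis"
  then obtain x y where "x \<in> A" "x \<notin> B" "y \<in> B" "y \<notin> A" by blast
  then show False using convex_subgroup_bound assms less_asym by metis
qed

lemma convex_subgroup_absorb:
  assumes "convex_subgroup A" "convex_subgroup B" "A \<subseteq> B"
  shows "A + B = B" "B + A = B"
proof -
  show "A + B = B"
    using assms convex_subgroup_zero[OF assms(1)] convex_subgroup_add[OF assms(2)]
    by (auto simp: set_plus_def) (metis add_0)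
  then show "B + A = B" by (simp add: add.commute)
qed

lemma convex_subgroup_add_idem: "convex_subgroup A \<Longrightarrow> A + A = A"
  by (rule convex_subgroup_absorb) auto

lemma convex_subgroup_plus_cases:
  assumes "convex_subgroup A" "convex_subgroup B" shows "A + B = A \<or> A + B = B"
  using convex_subgroup_chain[OF assms] convex_subgroup_absorb assms by metis

lemma convex_subgroup_plus:
  "\<lbrakk>convex_subgroup A; convex_subgroup B\<rbrakk> \<Longrightarrow> convex_subgroup (A + B)"
  using convex_subgroup_plus_cases by metis

lemma convex_subgroup_plus_upper:
  assumes "convex_subgroup A" "convex_subgroup B" shows "A \<subseteq> A + B" "B \<subseteq> A + B"
  using convex_subgroup_chain[OF assms] convex_subgroup_absorb[OF assms]
    convex_subgroup_absorb[OF assms(2,1)] by auto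

section \<open>Products and scalar multiples of convex subgroups\<close>

lemma convex_subgroup_times:
  assumes A: "convex_subgroup A" and B: "convex_subgroup B" shows "convex_subgroup (A * B)"
proof (rule convex_subgroupI)
  show "0 \<in> A * B"
    using set_times_intro[OF convex_subgroup_zero[OF A] convex_subgroup_zero[OF B]] by simp
  fix x y assume "x \<in> A * B"
  then obtain a b where x: "x = a * b" "a \<in> A" "b \<in> B" by (auto elim: set_times_elim)
  assume le: "\<bar>y\<bar> \<le> \<bar>x\<bar>"
  show "y \<in> A * B"
  proof (cases "b = 0")
    case True
    then show ?thesis using le x set_times_intro[OF x(2,3)] by simp
  next
    case False
    \<comment> \<open>Keeping the factor \<open>b\<close> and shrinking the other factor to
      \<open>y / b\<close> exhibits \<open>y\<close> as a product.\<close>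
    then have "\<bar>y / b\<bar> \<le> \<bar>a\<bar>" using le x by (simp add: divide_simps abs_mult)
    then have "y / b * b \<in> A * B"
      using convex_subgroup_abs[OF A x(2)] x(3) by (blast intro: set_times_intro)
    then show ?thesis using False by simp
  qed
qed (rule times_closed_add[OF A B])

lemma mem_scale_iff: "a \<noteq> 0 \<Longrightarrow> x \<in> a *o A \<longleftrightarrow> x / a \<in> A" for x a :: "'a::field"
  by (force simp: elt_set_times_def)

text \<open>Links the image notation for A/a in the theorem with the scalar multiples used in the
  computations.\<close>

lemma divide_image_eq_scale: "(\<lambda>x. x / a) ` A = (1 / a) *o A" for a :: "'a::field"
  by (auto simp: elt_set_times_def)

lemma zero_scale: "convex_subgroup A \<Longrightarrow> 0 *o A = {0}"
  using convex_subgroup_zero by (auto simp: elt_set_times_def)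

lemma convex_subgroup_0: "convex_subgroup {0}"
  by (auto simp: convex_subgroup_def)

lemma convex_subgroup_UNIV: "convex_subgroup UNIV"
  by (auto simp: convex_subgroup_def)

lemma convex_subgroup_scale:
  assumes A: "convex_subgroup A" shows "convex_subgroup (a *o A)"
proof (cases "a = 0")
  case True
  then show ?thesis using zero_scale[OF A] convex_subgroup_0 by metis
next
  case False
  show ?thesis
  proof (rule convex_subgroupI)
    show "0 \<in> a *o A" using False convex_subgroup_zero[OF A] by (simp add: mem_scale_iff)
    show "x + y \<in> a *o A" if "x \<in> a *o A" "y \<in> a *o A" for x y
      using that False convex_subgroup_add[OF A] by (simp add: mem_scale_iff add_divide_distrib)
    show "y \<in> a *o A" if "x \<in> a *o A" "\<bar>y\<bar> \<le> \<bar>x\<bar>" for x y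
      using that False convex_subgroup_abs[OF A, of "x / a" "y / a"]
      by (simp add: mem_scale_iff divide_right_mono)
  qed
qed

lemmas convex_subgroup_intros =
  convex_subgroup_plus convex_subgroup_times convex_subgroup_scale convex_subgroup_0

text \<open>For arbitrary sets only the inclusion from left to right holds. Here the sum is the
  larger of \<open>B\<close> and \<open>C\<close>, and multiplication by \<open>A\<close> preserves
  their inclusion, so both sides are the product with the larger one.\<close>

lemma times_plus_distrib:
  assumes "convex_subgroup A" "convex_subgroup B" "convex_subgroup C"
  shows "A * (B + C) = A * B + A * C"
proof -
  have "A * B \<subseteq> A * C" if "B \<subseteq> C" for B C using that by (rule set_times_mono2[OF subset_refl])
  then show ?thesis
    using convex_subgroup_chain[OF assms(2,3)]
      convex_subgroup_absorb[OF assms(2,3)] convex_subgroup_absorb[OF assms(3,2)]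
      convex_subgroup_absorb[OF convex_subgroup_times convex_subgroup_times] assms by metis
qed

text \<open>Serves the axiom s(xy) = s(x)y, where changing the sign of the representative must not
  affect the subgroup part of the product.\<close>

lemma uminus_scale:
  assumes "convex_subgroup A" shows "(- a) *o A = a *o A"
proof -
  have "(- c) *o A \<subseteq> c *o A" for c
    using convex_subgroup_uminus[OF assms] by (force simp: elt_set_times_def)
  from this[of a] this[of "- a"] show ?thesis by auto
qed

lemma scale_times: "(a *o A) * B = a *o (A * B)" for a :: "'a::comm_ring_1"
  by (simp add: set_times_rearrange3)

text \<open>Every \<open>p\<close> in \<open>A\<close> is dominated by \<open>a\<close>, so
  \<open>p * q / a\<close> is at most \<open>q\<close> in absolute value and stays in
  \<open>B\<close>.\<close>

lemma times_subset_scale: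
  assumes "convex_subgroup A" "convex_subgroup B" "a \<notin> A" shows "A * B \<subseteq> a *o B"
proof
  have a: "a \<noteq> 0" using assms convex_subgroup_zero by blast
  fix t assume "t \<in> A * B"
  then obtain p q where t: "t = p * q" "p \<in> A" "q \<in> B" by (auto elim: set_times_elim)
  have "\<bar>p * q\<bar> \<le> \<bar>a\<bar> * \<bar>q\<bar>"
    using convex_subgroup_bound[OF assms(1,3) t(2)] by (simp add: abs_mult mult_right_mono)
  then have "\<bar>t / a\<bar> \<le> \<bar>q\<bar>" using a t by (simp add: divide_simps mult.commute)
  then show "t \<in> a *o B" using convex_subgroup_abs[OF assms(2) t(3)] a by (simp add: mem_scale_iff)
qed

section \<open>Closure, commutativity and associativity of the operations on cosets\<close>

lemma Q_coset: "convex_subgroup A \<Longrightarrow> a +o A \<in> Q"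
  by (auto simp: Q_def)

lemma convex_subgroup_in_Q: "convex_subgroup A \<Longrightarrow> A \<in> Q"
  using Q_coset[of A 0] by simp

lemma Q_cases:
  assumes "x \<in> Q" obtains a A where "convex_subgroup A" "x = a +o A"
  using assms by (auto simp: Q_def)

lemma Q_add_coset_subgroup:
  "\<lbrakk>convex_subgroup A; convex_subgroup B\<rbrakk> \<Longrightarrow> Q_add (a +o A) B = a +o (A + B)"
  using Q_add_coset[of A B a 0] by simp

lemma Q_add_eq_plus: "\<lbrakk>x \<in> Q; y \<in> Q\<rbrakk> \<Longrightarrow> Q_add x y = x + y"
  by (elim Q_cases) (simp add: Q_add_coset set_plus_rearrange)

lemma Q_add_closed: "\<lbrakk>x \<in> Q; y \<in> Q\<rbrakk> \<Longrightarrow> Q_add x y \<in> Q"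
  by (elim Q_cases) (simp add: Q_add_coset Q_coset convex_subgroup_plus)

lemma Q_mult_closed: "\<lbrakk>x \<in> Q; y \<in> Q\<rbrakk> \<Longrightarrow> Q_mult x y \<in> Q"
  by (elim Q_cases) (simp add: Q_mult_coset Q_coset convex_subgroup_intros)

text \<open>Uniqueness is derived from commutativity alone, so neutral elements can be computed
  before the structure is known to be an assembly.\<close>

lemma neutral_eqI:
  assumes "is_neutral A f x e" "\<And>x y. \<lbrakk>x \<in> A; y \<in> A\<rbrakk> \<Longrightarrow> f x y = f y x"
  shows "neutral A f x = e"
  unfolding neutral_def
proof (rule the_equality)
  fix e' assume "is_neutral A f x e'"
  then show "e' = e" using assms unfolding is_neutral_def by metis
qed (rule assms)

lemma Q_add_commute: "\<lbrakk>x \<in> Q; y \<in> Q\<rbrakk> \<Longrightarrow> Q_add x y = Q_add y x"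
  by (simp add: Q_add_eq_plus add.commute)

lemma Q_mult_commute: "\<lbrakk>x \<in> Q; y \<in> Q\<rbrakk> \<Longrightarrow> Q_mult x y = Q_mult y x"
  by (elim Q_cases) (simp add: Q_mult_coset ac_simps)

text \<open>By distributivity both bracketings expand to abc plus the subgroup abC + acB + bcA + aBC
  + bAC + cAB + ABC.\<close>

lemma Q_mult_assoc:
  assumes "x \<in> Q" "y \<in> Q" "z \<in> Q"
  shows "Q_mult (Q_mult x y) z = Q_mult x (Q_mult y z)"
proof -
  from assms obtain a A b B c C where [simp]: "convex_subgroup A" "convex_subgroup B" "convex_subgroup C"
    and [simp]: "x = a +o A" "y = b +o B" "z = c +o C" by (elim Q_cases)
  have r: "(X + Y) * Z = X * Z + Y * Z"
    if "convex_subgroup X" "convex_subgroup Y" "convex_subgroup Z" for X Y Z :: "'a set"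
    using times_plus_distrib[of Z X Y] that by (simp add: mult.commute)
  have l: "X * (a *o Y) = a *o (X * Y)" for X Y and a :: 'a
    by (metis scale_times mult.commute)
  show ?thesis
    by (simp add: Q_mult_coset convex_subgroup_intros times_plus_distrib r scale_times l
        set_times_plus_distrib2 set_times_rearrange2 ac_simps)
qed

section \<open>The additive assembly\<close>

lemma is_neutral_Q:
  assumes A: "convex_subgroup A" shows "is_neutral Q Q_add (a +o A) A"
  unfolding is_neutral_def
proof (intro conjI ballI impI)
  show "A \<in> Q" using A by (rule convex_subgroup_in_Q)
  show "Q_add (a +o A) A = a +o A"
    by (simp add: A Q_add_coset_subgroup convex_subgroup_add_idem)
  fix g assume g: "g \<in> Q" and eq: "Q_add (a +o A) g = a +o A"
  obtain b B where B: "convex_subgroup B" and [simp]: "g = b +o B" using g by (elim Q_cases)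
  \<comment> \<open>Equality of cosets compares subgroups and representatives separately:
    \<open>g\<close> is absorbed by \<open>a +o A\<close> only if both its subgroup and its
    representative are absorbed by \<open>A\<close>.\<close>
  have "A + B = A" "b \<in> A"
    using eq coset_eq_iff[OF convex_subgroup_plus[OF A B] A, of "a + b" a]
      convex_subgroup_uminus[OF A, of "- b"] by (auto simp: Q_add_coset A B)
  then show "Q_add A g = A"
    using Q_add_coset[OF A B, of 0 b] coset_self[OF A] by simp
qed

lemma neutral_Q: "convex_subgroup A \<Longrightarrow> neutral Q Q_add (a +o A) = A"
  by (rule neutral_eqI[OF is_neutral_Q Q_add_commute])

lemma neutral_Q_subgroup: "convex_subgroup A \<Longrightarrow> neutral Q Q_add A = A"
  using neutral_Q[of A 0] by simp

lemma is_symmetric_Q: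
  assumes "convex_subgroup A" shows "is_symmetric Q Q_add (a +o A) (- a +o A)"
  using assms by (simp add: is_symmetric_def Q_coset neutral_Q Q_add_coset convex_subgroup_add_idem)

lemma assembly_Q_add: "assembly (Q :: 'a::linordered_field set set) Q_add"
proof
  show "(Q :: 'a set set) \<noteq> {}" using convex_subgroup_in_Q[OF convex_subgroup_0] by blast
next
  fix x y z :: "'a set" assume "x \<in> Q" "y \<in> Q" "z \<in> Q"
  then show "Q_add (Q_add x y) z = Q_add x (Q_add y z)"
    by (elim Q_cases) (simp add: Q_add_coset convex_subgroup_plus add.assoc)
next
  fix x :: "'a set" assume "x \<in> Q"
  then show "\<exists>e. is_neutral Q Q_add x e" "\<exists>s. is_symmetric Q Q_add x s"
    using is_neutral_Q is_symmetric_Q by (blast elim: Q_cases)+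
next
  fix x y :: "'a set" assume "x \<in> Q" "y \<in> Q"
  then show "neutral Q Q_add (Q_add x y) = neutral Q Q_add x \<or>
      neutral Q Q_add (Q_add x y) = neutral Q Q_add y"
    by (elim Q_cases) (simp add: Q_add_coset convex_subgroup_plus neutral_Q convex_subgroup_plus_cases)
qed (simp_all add: Q_add_closed Q_add_commute)

lemma symmetric_Q:
  assumes "convex_subgroup A" shows "symmetric Q Q_add (a +o A) = - a +o A"
proof -
  interpret assembly Q Q_add by (rule assembly_Q_add)
  show ?thesis
    using symmetric_unique is_symmetric_symmetric is_symmetric_Q[OF assms] Q_coset[OF assms] by blast
qed

section \<open>The multiplicative assembly of zeroless cosets\<close>

abbreviation (input) Z :: "'a::linordered_field set set" where "Z \<equiv> zeroless Q Q_add"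

lemma coset_in_Z_iff:
  assumes A: "convex_subgroup A" shows "a +o A \<in> Z \<longleftrightarrow> a \<notin> A"
  using coset_eq_iff[OF A A, of 0 a]
  by (auto simp: zeroless_def Q_coset A neutral_Q)

lemma Z_cases:
  assumes "x \<in> Z" obtains a A where "convex_subgroup A" "a \<notin> A" "a \<noteq> 0" "x = a +o A"
proof -
  have "x \<in> Q" using assms by (simp add: zeroless_def)
  then obtain a A where *: "convex_subgroup A" "x = a +o A" by (elim Q_cases)
  then have "a \<notin> A" using assms coset_in_Z_iff by blast
  moreover have "a \<noteq> 0" using calculation convex_subgroup_zero[OF *(1)] by blast
  ultimately show ?thesis using * that by blast
qed

lemma Q_mult_zeroless:
  assumes A: "convex_subgroup A" and B: "convex_subgroup B" and a: "a \<notin> A"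
  shows "Q_mult (a +o A) (b +o B) = (a * b) +o (a *o B + b *o A)"
proof -
  have "a *o B + A * B = a *o B"
    by (rule convex_subgroup_absorb) (simp_all add: A B convex_subgroup_intros times_subset_scale a)
  then have "a *o B + b *o A + A * B = a *o B + b *o A"
    by (metis add.assoc add.commute)
  then show ?thesis by (simp add: Q_mult_coset A B)
qed

lemma scale_one_divide: "a \<noteq> 0 \<Longrightarrow> a *o ((1 / a) *o A) = A" for a :: "'a::field"
  by (simp add: set_times_rearrange2)

text \<open>The unity is \<open>a +o A\<close> divided by its representative. It is zeroless because
  \<open>1\<close> in A/a would mean \<open>a\<close> in \<open>A\<close>, and its product with
  \<open>a +o A\<close> has subgroup part A + A = A.\<close>

lemma is_neutral_Z:
  assumes A: "convex_subgroup A" and a: "a \<notin> A"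
  shows "is_neutral Z Q_mult (a +o A) (1 +o ((1 / a) *o A))"
  unfolding is_neutral_def
proof (intro conjI ballI impI)
  have a0: "a \<noteq> 0" using a convex_subgroup_zero[OF A] by blast
  have A': "convex_subgroup ((1 / a) *o A)" using A by (rule convex_subgroup_scale)
  have one: "1 \<notin> (1 / a) *o A" using a a0 by (simp add: mem_scale_iff)
  show "1 +o ((1 / a) *o A) \<in> Z" using one by (simp add: coset_in_Z_iff A')
  show "Q_mult (a +o A) (1 +o ((1 / a) *o A)) = a +o A"
    by (simp add: Q_mult_zeroless A A' a scale_one_divide a0 convex_subgroup_add_idem)
  fix g assume "g \<in> Z" and eq: "Q_mult (a +o A) g = a +o A"
  then obtain b B where B: "convex_subgroup B" "b \<notin> B" "b \<noteq> 0" and g: "g = b +o B" by (elim Z_cases)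
  have "(a * b) +o (a *o B + b *o A) = a +o A"
    using eq by (simp add: g Q_mult_zeroless A B a)
  then have *: "a *o B + b *o A = A" "a - a * b \<in> A"
    using coset_eqD[of "a *o B + b *o A" A] A B convex_subgroup_intros by metis+
  \<comment> \<open>Dividing the two relations just obtained by \<open>a\<close> gives exactly the
    conditions for the unity to absorb \<open>g\<close>.\<close>
  have "B + b *o ((1 / a) *o A) = (1 / a) *o (a *o B + b *o A)"
    using a0 by (simp add: set_times_plus_distrib2 set_times_rearrange2 mult.commute)
  then have sum: "B + b *o ((1 / a) *o A) = (1 / a) *o A" using * by simp
  have "1 - b \<in> (1 / a) *o A" using * a0 by (simp add: mem_scale_iff algebra_simps)
  then show "Q_mult (1 +o ((1 / a) *o A)) g = 1 +o ((1 / a) *o A)"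
    by (simp add: g Q_mult_zeroless A' B one sum coset_eq_iff)
qed

lemma Z_subset_Q: "x \<in> Z \<Longrightarrow> x \<in> Q"
  by (simp add: zeroless_def)

lemma neutral_Z:
  assumes "convex_subgroup A" "a \<notin> A"
  shows "neutral Z Q_mult (a +o A) = 1 +o ((1 / a) *o A)"
  using is_neutral_Z[OF assms] by (rule neutral_eqI) (simp add: Q_mult_commute Z_subset_Q)

text \<open>The subgroup A/a^2 is the first-order error of 1/a when \<open>a\<close> varies by
  \<open>A\<close>. Both a(A/a^2) and (1/a)A equal A/a, so the product with \<open>a +o A\<close> is
  the unity 1 + A/a.\<close>

lemma is_symmetric_Z:
  assumes A: "convex_subgroup A" and a: "a \<notin> A"
  shows "is_symmetric Z Q_mult (a +o A) ((1 / a) +o ((1 / a\<^sup>2) *o A))"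
proof -
  have a0: "a \<noteq> 0" using a convex_subgroup_zero[OF A] by blast
  have A': "convex_subgroup ((1 / a\<^sup>2) *o A)" using A by (rule convex_subgroup_scale)
  have a': "1 / a \<notin> (1 / a\<^sup>2) *o A"
    using a a0 by (simp add: mem_scale_iff power2_eq_square)
  have "a *o ((1 / a\<^sup>2) *o A) = (1 / a) *o A"
    using a0 by (simp add: set_times_rearrange2 power2_eq_square)
  then show ?thesis
    using a0 A A' a a' by (simp add: is_symmetric_def coset_in_Z_iff neutral_Z Q_mult_zeroless
        convex_subgroup_add_idem convex_subgroup_scale)
qed

text \<open>The sum equals one of its two summands, and dividing by \<open>a\<close> or
  \<open>b\<close> would put \<open>b\<close> into \<open>B\<close> or \<open>a\<close> into
  \<open>A\<close>. Hence products of zeroless cosets are zeroless.\<close>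

lemma mult_notin:
  assumes "convex_subgroup A" "convex_subgroup B" "a \<notin> A" "b \<notin> B" "a \<noteq> 0" "b \<noteq> 0"
  shows "a * b \<notin> a *o B + b *o A"
proof -
  have "a * b \<notin> a *o B" "a * b \<notin> b *o A" using assms by (simp_all add: mem_scale_iff)
  then show ?thesis
    using convex_subgroup_plus_cases[of "a *o B" "b *o A"] assms convex_subgroup_scale by metis
qed

lemma Z_mult_closed: "\<lbrakk>x \<in> Z; y \<in> Z\<rbrakk> \<Longrightarrow> Q_mult x y \<in> Z"
  by (elim Z_cases) (simp add: Q_mult_zeroless coset_in_Z_iff convex_subgroup_intros mult_notin)

lemma assembly_Z: "assembly (Z :: 'a::linordered_field set set) Q_mult"
proof
  have "1 +o {0} \<in> (Z :: 'a set set)" by (simp add: coset_in_Z_iff convex_subgroup_0)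
  then show "(Z :: 'a set set) \<noteq> {}" by blast
next
  fix x :: "'a set" assume "x \<in> Z"
  then show "\<exists>e. is_neutral Z Q_mult x e" "\<exists>s. is_symmetric Z Q_mult x s"
    using is_neutral_Z is_symmetric_Z by (blast elim: Z_cases)+
next
  fix x y :: "'a set" assume "x \<in> Z" "y \<in> Z"
  then obtain a A b B where A: "convex_subgroup A" "a \<notin> A" "a \<noteq> 0" "x = a +o A"
    and B: "convex_subgroup B" "b \<notin> B" "b \<noteq> 0" "y = b +o B" by (elim Z_cases)
  \<comment> \<open>Relative errors add under multiplication: the subgroup of the unity of the
    product is A/a + B/b, which is one of the two summands.\<close>
  have "(1 / (a * b)) *o (a *o B + b *o A) = (1 / b) *o B + (1 / a) *o A"
    using A B by (simp add: set_times_plus_distrib2 set_times_rearrange2)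
  then have "neutral Z Q_mult (Q_mult x y) = 1 +o ((1 / b) *o B + (1 / a) *o A)"
    using A B by (simp add: Q_mult_zeroless neutral_Z mult_notin convex_subgroup_intros)
  moreover have "neutral Z Q_mult x = 1 +o ((1 / a) *o A)" "neutral Z Q_mult y = 1 +o ((1 / b) *o B)"
    using A B by (simp_all add: neutral_Z)
  ultimately show "neutral Z Q_mult (Q_mult x y) = neutral Z Q_mult x \<or>
      neutral Z Q_mult (Q_mult x y) = neutral Z Q_mult y"
    using convex_subgroup_plus_cases[OF convex_subgroup_scale convex_subgroup_scale] A B by metis
qed (rule Z_mult_closed Q_mult_commute Q_mult_assoc; simp add: Z_subset_Q)+

lemma symmetric_Z:
  assumes "convex_subgroup A" "a \<notin> A"
  shows "symmetric Z Q_mult (a +o A) = (1 / a) +o ((1 / a\<^sup>2) *o A)"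
proof -
  interpret assembly Z Q_mult by (rule assembly_Z)
  have "a +o A \<in> Z" using assms by (simp add: coset_in_Z_iff)
  then show ?thesis
    using symmetric_unique is_symmetric_symmetric is_symmetric_Z[OF assms] by blast
qed

section \<open>Axioms linking addition and multiplication\<close>

lemma Q_mult_subgroup:
  assumes "convex_subgroup A" "convex_subgroup B"
  shows "Q_mult A (b +o B) = b *o A + A * B"
proof -
  \<comment> \<open>As a coset, \<open>A\<close> has representative 0, so the term 0B of the product
    formula collapses to \<open>{0}\<close>.\<close>
  have "{0} + X = X" for X :: "'a set" by (simp flip: set_zero)
  then show ?thesis using Q_mult_coset[OF assms, of 0 b] by (simp add: zero_scale assms)
qed

lemma association_Q: "association (Q :: 'a::linordered_field set set) Q_add Q_mult"
proof (rule association.intro[OF assembly_Q_add _ assembly_Z])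
  fix x y z :: "'a set" assume "x \<in> Q" "y \<in> Q" "z \<in> Q"
  then obtain a A b B c C where ABC: "convex_subgroup A" "convex_subgroup B" "convex_subgroup C"
    and [simp]: "x = a +o A" "y = b +o B" "z = c +o C" by (elim Q_cases)
  \<comment> \<open>\<open>R\<close> is the correction e(x)y + e(x)z. It absorbs (b + c)A and A(B +
    C), so both sides of the distributive law become a(b + c) + a(B + C) + R.\<close>
  define R where "R = (b *o A + A * B) + (c *o A + A * C)"
  have R: "convex_subgroup R" unfolding R_def by (intro convex_subgroup_intros ABC)
  have sub: "(b + c) *o A \<subseteq> b *o A + c *o A"
    by (auto simp: elt_set_times_def distrib_right intro!: set_plus_intro)
  have "(b + c) *o A + (b *o A + c *o A) = b *o A + c *o A"
    by (intro convex_subgroup_absorb sub convex_subgroup_intros ABC)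
  then have "(b + c) *o A + R = R" unfolding R_def by (metis (no_types, lifting) add.assoc add.left_commute)
  have AR: "A * (B + C) + R = R"
  proof (rule convex_subgroup_absorb)
    have "A * B \<subseteq> R" "A * C \<subseteq> R" unfolding R_def
      using convex_subgroup_plus_upper ABC convex_subgroup_intros by (meson order_trans)+
    then have "A * B + A * C \<subseteq> R + R" by (rule set_plus_mono2)
    then show "A * (B + C) \<subseteq> R" by (simp add: times_plus_distrib ABC convex_subgroup_add_idem R)
  qed (intro convex_subgroup_intros ABC R)+
  have "Q_add (Q_mult x y) (Q_mult x z) = (a * (b + c)) +o (a *o (B + C) + R)"
    by (simp add: Q_mult_coset Q_add_coset ABC convex_subgroup_intros R_def
        set_times_plus_distrib2 distrib_left ac_simps)
  also have "\<dots> = (a * (b + c)) +o (a *o (B + C) + (b + c) *o A + A * (B + C) + R)"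
    by (simp add: add.assoc AR \<open>(b + c) *o A + R = R\<close>)
  also have "\<dots> = Q_add (Q_add (Q_mult x (Q_add y z)) (Q_mult A y)) (Q_mult A z)"
    by (simp add: Q_mult_coset Q_add_coset Q_add_coset_subgroup Q_mult_subgroup ABC convex_subgroup_intros R_def add.assoc)
  finally show "Q_add (Q_mult x y) (Q_mult x z) =
      Q_add (Q_add (Q_mult x (Q_add y z)) (Q_mult (neutral Q Q_add x) y)) (Q_mult (neutral Q Q_add x) z)"
    by (simp add: neutral_Q ABC)
next
  fix x y :: "'a set" assume "x \<in> Q" "y \<in> Q"
  then obtain a A b B where AB: "convex_subgroup A" "convex_subgroup B"
    and [simp]: "x = a +o A" "y = b +o B" by (elim Q_cases)
  have N: "convex_subgroup (b *o A + A * B)" "convex_subgroup (a *o B + A * B)"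
    by (intro convex_subgroup_intros AB)+
  show "\<exists>w\<in>Q. Q_mult (neutral Q Q_add x) y = neutral Q Q_add w"
    using N(1) by (intro bexI[of _ "b *o A + A * B"])
      (simp_all add: neutral_Q neutral_Q_subgroup Q_mult_subgroup AB convex_subgroup_in_Q)
  \<comment> \<open>Idempotence lets the single quadratic term be shared between e(x)y and
    e(y)x.\<close>
  have "A * B + A * B = A * B" by (intro convex_subgroup_add_idem convex_subgroup_intros AB)
  then have sum: "a *o B + b *o A + A * B = (b *o A + A * B) + (a *o B + A * B)"
    by (metis (no_types, lifting) add.assoc add.commute)
  have "neutral Q Q_add (Q_mult x y) = a *o B + b *o A + A * B"
    by (simp add: Q_mult_coset neutral_Q AB convex_subgroup_intros)
  also have "\<dots> = (b *o A + A * B) + (a *o B + A * B)" by (rule sum)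
  also have "\<dots> = Q_add (b *o A + A * B) (a *o B + A * B)"
    using N by (simp add: Q_add_eq_plus convex_subgroup_in_Q)
  also have "\<dots> = Q_add (Q_mult (neutral Q Q_add x) y) (Q_mult (neutral Q Q_add y) x)"
    by (simp add: neutral_Q Q_mult_subgroup AB mult.commute[of B])
  finally show "neutral Q Q_add (Q_mult x y) =
      Q_add (Q_mult (neutral Q Q_add x) y) (Q_mult (neutral Q Q_add y) x)" .
  show "symmetric Q Q_add (Q_mult x y) = Q_mult (symmetric Q Q_add x) y"
    by (simp add: symmetric_Q Q_mult_coset AB convex_subgroup_intros uminus_scale)
next
  fix x :: "'a set" assume x: "x \<in> Q" "x \<noteq> neutral Q Q_add x"
  then have "x \<in> Z" by (simp add: zeroless_def)
  then obtain a A where A: "convex_subgroup A" "a \<notin> A" "a \<noteq> 0" and [simp]: "x = a +o A" by (elim Z_cases)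
  have A': "convex_subgroup ((1 / a) *o A)" "convex_subgroup ((1 / a\<^sup>2) *o A)"
    using A(1) by (simp_all add: convex_subgroup_scale)
  \<comment> \<open>The product e(x)d(x) is A/a + A(A/a^2), whose second term is absorbed because
    \<open>a\<close> dominates \<open>A\<close>. What remains is the subgroup of the unity.\<close>
  have "A * ((1 / a\<^sup>2) *o A) \<subseteq> a *o ((1 / a\<^sup>2) *o A)"
    by (rule times_subset_scale[OF A(1) A'(2) A(2)])
  also have "\<dots> = (1 / a) *o A" using A by (simp add: set_times_rearrange2 power2_eq_square)
  finally have "(1 / a) *o A + A * ((1 / a\<^sup>2) *o A) = (1 / a) *o A"
    by (intro convex_subgroup_absorb convex_subgroup_intros A)
  then show "neutral Q Q_add (neutral Z Q_mult x) = Q_mult (neutral Q Q_add x) (symmetric Z Q_mult x)"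
    using A A' by (simp add: neutral_Q neutral_Z symmetric_Z Q_mult_subgroup)
qed (rule Q_mult_closed)

section \<open>The order on cosets\<close>

lemma Q_le_subset: "x \<subseteq> y \<Longrightarrow> Q_le x y"
  by (auto simp: Q_le_def)

text \<open>Two cosets meet exactly when \<open>b - a\<close> lies in \<open>A + B\<close>. If they
  meet, they share a representative and the order is inclusion; otherwise the gap
  \<open>b - a\<close> is positive and dominates both subgroups. The monotonicity laws of
  multiplication rest on this dichotomy.\<close>

lemma Q_le_cases:
  assumes A: "convex_subgroup A" and B: "convex_subgroup B" and le: "Q_le (a +o A) (b +o B)"
  obtains c where "A \<subseteq> B" "a +o A = c +o A" "b +o B = c +o B"
  | "a < b" "b - a \<notin> A" "b - a \<notin> B"
proof (cases "b - a \<in> A + B")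
  case True
  then obtain p q where pq: "b - a = p + q" "p \<in> A" "q \<in> B" by (auto elim: set_plus_elim)
  \<comment> \<open>The common representative: \<open>c\<close> equals both \<open>a + p\<close> and
    \<open>b - q\<close>.\<close>
  define c where "c = a + p"
  have d: "c - a = p" "c - b = - q" using pq by (simp_all add: c_def algebra_simps)
  then have eq: "a +o A = c +o A" "b +o B = c +o B"
    using pq(2,3) convex_subgroup_uminus[OF B] by (simp_all add: coset_eq_iff A B d)
  have "A \<subseteq> B"
  proof (rule ccontr)
    assume "\<not> A \<subseteq> B"
    then obtain x where x: "x \<in> A" "x \<notin> B" by blast
    \<comment> \<open>Otherwise \<open>c + \<bar>x\<bar>\<close> would lie above all of
      \<open>c +o B\<close>.\<close>
    have "\<bar>x\<bar> \<in> A" using convex_subgroup_abs[OF A x(1)] by simp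
    then have "c + \<bar>x\<bar> \<in> c +o A" by (simp add: mem_coset_iff)
    then obtain y where "y \<in> c +o B" "c + \<bar>x\<bar> \<le> y" using le unfolding eq Q_le_def by blast
    then have "\<bar>x\<bar> \<le> \<bar>y - c\<bar>" "y - c \<in> B" by (auto simp: mem_coset_iff)
    then show False using convex_subgroup_abs[OF B] x(2) by blast
  qed
  then show thesis using that(1) eq by blast
next
  case False
  have nA: "b - a \<notin> A" and nB: "b - a \<notin> B"
    using False convex_subgroup_plus_upper[OF A B] by blast+
  have "a \<in> a +o A" using convex_subgroup_zero[OF A] by (simp add: mem_coset_iff)
  then obtain y where y: "y \<in> b +o B" "a \<le> y" using le unfolding Q_le_def by blast
  have "\<bar>y - b\<bar> < \<bar>b - a\<bar>" using convex_subgroup_bound[OF B nB] y(1) by (simp add: mem_coset_iff)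
  then have "a < b" using y(2) by linarith
  then show thesis using that(2) nA nB by blast
qed

lemma Q_le_if_gap:
  assumes A: "convex_subgroup A" and "a < b" "b - a \<notin> A" and B: "convex_subgroup B"
  shows "Q_le (a +o A) (b +o B)"
  unfolding Q_le_def
proof (intro ballI bexI)
  fix x assume "x \<in> a +o A"
  then have "\<bar>x - a\<bar> < \<bar>b - a\<bar>" using convex_subgroup_bound[OF A assms(3)] by (simp add: mem_coset_iff)
  then show "x \<le> b" using \<open>a < b\<close> by linarith
  show "b \<in> b +o B" using convex_subgroup_zero[OF B] by (simp add: mem_coset_iff)
qed

text \<open>This holds for arbitrary sets: an element of \<open>x\<close> with no upper bound in
  \<open>y\<close> is itself an upper bound of \<open>y\<close>.\<close>

lemma Q_le_total: "Q_le x y \<or> Q_le y x"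
  unfolding Q_le_def by (meson linear)

lemma Q_le_trans: "\<lbrakk>Q_le x y; Q_le y z\<rbrakk> \<Longrightarrow> Q_le x z"
  unfolding Q_le_def by (meson order_trans)

lemma Q_le_antisym:
  assumes "x \<in> Q" "y \<in> Q" "Q_le x y" "Q_le y x" shows "x = y"
proof -
  obtain a A b B where A: "convex_subgroup A" and B: "convex_subgroup B"
    and [simp]: "x = a +o A" "y = b +o B" using assms(1,2) by (elim Q_cases)
  have le: "Q_le (a +o A) (b +o B)" "Q_le (b +o B) (a +o A)" using assms(3,4) by simp_all
  show ?thesis
  proof (rule Q_le_cases[OF A B le(1)])
    fix c assume c: "A \<subseteq> B" "a +o A = c +o A" "b +o B = c +o B"
    \<comment> \<open>For the common representative the gap alternative would read
      \<open>c < c\<close>, so only inclusion remains.\<close>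
    have "Q_le (c +o B) (c +o A)" using le(2) c by simp
    then have "B \<subseteq> A" by (rule Q_le_cases[OF B A]) auto
    then show "x = y" using c by simp
  next
    assume ab: "a < b" "b - a \<notin> A" "b - a \<notin> B"
    then have n: "a - b \<notin> A" "a - b \<notin> B"
      using convex_subgroup_uminus[OF A, of "a - b"] convex_subgroup_uminus[OF B, of "a - b"] by auto
    show "x = y"
    proof (rule Q_le_cases[OF B A le(2)])
      fix c assume c: "B \<subseteq> A" "b +o B = c +o B" "a +o A = c +o A"
      have "c - b \<in> A" "c - a \<in> A"
        using c A B by (auto simp: coset_eq_iff)
      then have "(c - b) - (c - a) \<in> A" by (rule convex_subgroup_diff[OF A])
      then show ?thesis using n by simp
    qed (use ab in auto)
  qed
qed

lemma linear_order_Q: "linear_order_on Q {(x, y) \<in> Q \<times> Q. Q_le x y}"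
  unfolding linear_order_on_def partial_order_on_def preorder_on_def
proof (intro conjI)
  show "refl_on Q {(x, y) \<in> Q \<times> Q. Q_le x y}" by (auto simp: refl_on_def Q_le_subset)
  show "trans {(x, y) \<in> Q \<times> Q. Q_le x y}" by (auto simp: trans_def intro: Q_le_trans)
  show "antisym {(x, y) \<in> Q \<times> Q. Q_le x y}" by (auto simp: antisym_def dest: Q_le_antisym)
  show "total_on Q {(x, y) \<in> Q \<times> Q. Q_le x y}" using Q_le_total by (auto simp: total_on_def)
qed auto

lemma Q_le_add_mono:
  assumes "x \<in> Q" "y \<in> Q" "z \<in> Q" "Q_le x y" shows "Q_le (Q_add x z) (Q_add y z)"
  using assms unfolding Q_le_def
  by (auto simp: Q_add_eq_plus elim!: set_plus_elim) (meson add_right_mono set_plus_intro)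

lemma Q_le_mult_mono:
  assumes x: "x \<in> Q" and y: "y \<in> Q" and z: "z \<in> Q"
    and pos: "Q_le (neutral Q Q_add x) x" "neutral Q Q_add x \<noteq> x" and le: "Q_le y z"
  shows "Q_le (Q_mult x y) (Q_mult x z)"
proof -
  obtain a A where A: "convex_subgroup A" and x_eq: "x = a +o A" using x by (elim Q_cases)
  obtain b B c C where B: "convex_subgroup B" and C: "convex_subgroup C"
    and yz: "y = b +o B" "z = c +o C" using y z by (elim Q_cases)
  have a: "a \<notin> A" using pos(2) coset_self[OF A] by (auto simp: x_eq neutral_Q A)
  have "Q_le (0 +o A) (a +o A)" using pos(1) by (simp add: x_eq neutral_Q A)
  then have a0: "0 < a"
  proof (rule Q_le_cases[OF A A])
    fix c assume "0 +o A = c +o A" "a +o A = c +o A"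
    then show "0 < a" using coset_eq_iff[OF A A, of 0 a] a by simp
  qed
  have "Q_le (b +o B) (c +o C)" using le by (simp add: yz)
  then have "Q_le (Q_mult (a +o A) (b +o B)) (Q_mult (a +o A) (c +o C))"
  proof (rule Q_le_cases[OF B C])
    fix d assume d: "B \<subseteq> C" "b +o B = d +o B" "c +o C = d +o C"
    then have "a *o B + d *o A \<subseteq> a *o C + d *o A"
      by (intro set_plus_mono2 set_times_mono subset_refl)
    then show ?thesis
      unfolding d(2,3) by (simp add: Q_mult_zeroless A B C a Q_le_subset set_plus_mono)
  next
    assume bc: "b < c" "c - b \<notin> B" "c - b \<notin> C"
    show ?thesis
      unfolding Q_mult_zeroless[OF A B a] Q_mult_zeroless[OF A C a] Q_le_def
    proof (intro ballI)
      fix t assume "t \<in> (a * b) +o (a *o B + b *o A)"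
      then obtain p q where t: "t = a * b + (a * q + b * p)" and p: "p \<in> A" and q: "q \<in> B"
        by (auto simp: elt_set_plus_def elt_set_times_def elim!: set_plus_elim)
      \<comment> \<open>The goal \<open>t \<le> a * c + c * p\<close> amounts to aq <= (c - b)(a +
        p). Since \<open>A\<close> and \<open>B\<close> are closed under doubling, a + p is at least
        a/2 and q at most (c - b)/2, so both sides are separated by a(c - b)/2.\<close>
      have "\<bar>p + p\<bar> < \<bar>a\<bar>" "\<bar>q + q\<bar> < \<bar>c - b\<bar>"
        using convex_subgroup_bound A B a bc p q convex_subgroup_add by blast+
      then have "a \<le> 2 * (a + p)" "2 * q \<le> c - b" using a0 bc by (auto simp: abs_less_iff)
      then have "a * (2 * q) \<le> a * (c - b)" "(c - b) * a \<le> (c - b) * (2 * (a + p))"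
        using a0 bc by (intro mult_left_mono; simp)+
      then have "2 * (a * q) \<le> 2 * ((c - b) * (a + p))" by (simp add: algebra_simps)
      then have "t \<le> a * c + c * p" by (simp add: t algebra_simps)
      moreover have "a * c + (a * 0 + c * p) \<in> (a * c) +o (a *o C + c *o A)"
        using p convex_subgroup_zero[OF C] by (intro set_plus_intro2 set_plus_intro set_times_intro2)
      ultimately show "\<exists>y\<in>(a * c) +o (a *o C + c *o A). t \<le> y" by auto
    qed
  qed
  then show ?thesis by (simp add: x_eq yz)
qed

text \<open>Both products are convex subgroups, so it suffices to prove the inclusion of bA + AB in
  cA + AC.\<close>

lemma Q_le_neutral_mult_mono:
  assumes x: "x \<in> Q" and y: "y \<in> Q" and z: "z \<in> Q"
    and pos: "Q_le (neutral Q Q_add y) y" and le: "Q_le y z"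
  shows "Q_le (Q_mult (neutral Q Q_add x) y) (Q_mult (neutral Q Q_add x) z)"
proof -
  obtain a A where A: "convex_subgroup A" and x_eq: "x = a +o A" using x by (elim Q_cases)
  obtain b' B c C where B: "convex_subgroup B" and C: "convex_subgroup C"
    and y_eq': "y = b' +o B" and z_eq: "z = c +o C" using y z by (elim Q_cases)
  have "Q_le (0 +o B) (b' +o B)" using pos by (simp add: y_eq' neutral_Q B)
  \<comment> \<open>Either \<open>y\<close> shares a representative with its neutral element and 0
    serves, or the gap alternative makes \<open>b'\<close> positive.\<close>
  then have "\<exists>b\<ge>0. y = b +o B"
  proof (rule Q_le_cases[OF B B])
    fix d assume "0 +o B = d +o B" "b' +o B = d +o B"
    then have "y = 0 +o B" by (simp add: y_eq')
    then show ?thesis by blast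
  qed (use y_eq' in \<open>auto intro: less_imp_le\<close>)
  then obtain b where b0: "0 \<le> b" and y_eq: "y = b +o B" by blast
  have N: "convex_subgroup (c *o A + A * C)" by (intro convex_subgroup_intros A C)
  have "b *o A + A * B \<subseteq> c *o A + A * C"
  proof
    fix t assume "t \<in> b *o A + A * B"
    then obtain p p' q where t: "t = b * p + p' * q" and p: "p \<in> A" "p' \<in> A" and q: "q \<in> B"
      by (auto simp: elt_set_times_def elim!: set_plus_elim set_times_elim)
    \<comment> \<open>With \<open>P\<close> bounding both elements of \<open>A\<close> and
      \<open>w\<close> in \<open>z\<close> bounding \<open>b + \<bar>q\<bar>\<close>, the element
      \<open>t\<close> is at most P(b + |q|) <= Pw = cP + Pr in absolute value.\<close>
    define P where "P = max \<bar>p\<bar> \<bar>p'\<bar>"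
    have PA: "P \<in> A" using p convex_subgroup_abs[OF A] by (simp add: P_def max_def)
    have P0: "0 \<le> P" "\<bar>p\<bar> \<le> P" "\<bar>p'\<bar> \<le> P" by (auto simp: P_def)
    have "\<bar>q\<bar> \<in> B" using convex_subgroup_abs[OF B q] by simp
    then have "b + \<bar>q\<bar> \<in> y" by (simp add: y_eq mem_coset_iff)
    then obtain w where w: "w \<in> z" "b + \<bar>q\<bar> \<le> w" using le unfolding Q_le_def by blast
    define r where "r = w - c"
    have r: "r \<in> C" using w by (simp add: r_def z_eq mem_coset_iff)
    have "\<bar>t\<bar> \<le> b * \<bar>p\<bar> + \<bar>p'\<bar> * \<bar>q\<bar>"
      unfolding t using abs_triangle_ineq[of "b * p" "p' * q"] b0 by (simp add: abs_mult)
    also have "\<dots> \<le> b * P + P * \<bar>q\<bar>" using P0 b0 by (intro add_mono mult_left_mono mult_right_mono) auto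
    also have "\<dots> = P * (b + \<bar>q\<bar>)" by (simp add: algebra_simps)
    also have "\<dots> \<le> P * w" using w P0 by (intro mult_left_mono)
    also have "\<dots> = c * P + P * r" by (simp add: r_def algebra_simps)
    finally have "\<bar>t\<bar> \<le> \<bar>c * P + P * r\<bar>" by simp
    moreover have "c * P + P * r \<in> c *o A + A * C"
      using PA r by (intro set_plus_intro set_times_intro2 set_times_intro)
    ultimately show "t \<in> c *o A + A * C" using convex_subgroup_abs[OF N] by blast
  qed
  then show ?thesis by (simp add: x_eq y_eq z_eq neutral_Q Q_mult_subgroup A B C Q_le_subset)
qed

lemma ordered_association_Q:
  "ordered_association (Q :: 'a::linordered_field set set) Q_add Q_mult Q_le"
proof -
  interpret association "Q :: 'a set set" Q_add Q_mult by (rule association_Q)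
  show ?thesis
  proof
    fix x y :: "'a set" assume "x \<in> Q" "y \<in> Q" and eq: "Q_add y (e x) = e x"
    then obtain a A b B where A: "convex_subgroup A" and B: "convex_subgroup B"
      and xy: "x = a +o A" "y = b +o B" by (elim Q_cases)
    \<comment> \<open>Absorption means that \<open>y\<close> is contained in \<open>A\<close>. Then
      so is \<open>s y\<close>, and inclusion implies \<open>Q_le\<close>.\<close>
    have "b +o (B + A) = 0 +o A"
      using eq by (simp add: xy neutral_Q A B Q_add_coset_subgroup)
    then have "B + A = A" "- b \<in> A"
      using coset_eq_iff[OF convex_subgroup_plus[OF B A] A, of b 0] by auto
    then have BA: "B \<subseteq> A" and b: "- b \<in> A" "b \<in> A"
      using convex_subgroup_plus_upper[OF B A] convex_subgroup_uminus[OF A, of "- b"] by auto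
    have "y \<subseteq> b +o A" "s y \<subseteq> - b +o A" using BA by (simp_all add: xy symmetric_Q B set_plus_mono)
    then show "Q_le y (e x) \<and> Q_le (s y) (e x)"
      using b by (simp add: xy neutral_Q A coset_self Q_le_subset)
  qed (rule linear_order_Q Q_le_add_mono Q_le_mult_mono Q_le_neutral_mult_mono; assumption)+
qed

section \<open>The existence axioms of a solid\<close>

lemma convex_subgroup_limited:
  "convex_subgroup {x :: 'a::linordered_field. \<exists>n::nat. \<bar>x\<bar> \<le> of_nat n}" (is "convex_subgroup ?L")
proof (rule convex_subgroupI)
  show "0 \<in> ?L" by (auto intro: exI[of _ 0])
  fix x y assume x: "x \<in> ?L"
  show "y \<in> ?L" if "\<bar>y\<bar> \<le> \<bar>x\<bar>" using x that order_trans by blast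
  assume "y \<in> ?L"
  with x obtain m n :: nat where "\<bar>x\<bar> \<le> of_nat m" "\<bar>y\<bar> \<le> of_nat n" by blast
  then have "\<bar>x + y\<bar> \<le> of_nat (m + n)" using abs_triangle_ineq[of x y] by simp
  then show "x + y \<in> ?L" by blast
qed

lemma solid_Q:
  assumes nonarchimedean: "\<exists>x::'a::linordered_field. \<forall>n::nat. of_nat n < x"
  shows "solid (Q :: 'a set set) Q_add Q_mult Q_le"
proof -
  interpret ordered_association "Q :: 'a set set" Q_add Q_mult Q_le by (rule ordered_association_Q)
  have zero_add: "{0} + X = X" for X :: "'a set" by (simp flip: set_zero)
  have zeroQ: "{0} \<in> (Q :: 'a set set)" and UNIVQ: "UNIV \<in> (Q :: 'a set set)"
    using convex_subgroup_0 convex_subgroup_UNIV by (blast intro: convex_subgroup_in_Q)+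
  show ?thesis
  proof
    have b1: "Q_add {0} x = x" if "x \<in> Q" for x :: "'a set"
      using that zeroQ by (simp add: Q_add_eq_plus zero_add)
    have b2: "Q_add (e x) UNIV = UNIV" if x: "x \<in> Q" for x :: "'a set"
    proof -
      obtain a A where A: "convex_subgroup A" "x = a +o A" using x by (elim Q_cases)
      have "A + UNIV = UNIV" by (rule convex_subgroup_absorb[OF A(1) convex_subgroup_UNIV]) simp
      then show ?thesis by (simp add: neutral_Q A Q_add_eq_plus UNIVQ convex_subgroup_in_Q)
    qed
    have b3: "\<exists>a\<in>Q. x = Q_add a (e x) \<and> e a = {0}" if x: "x \<in> Q" for x :: "'a set"
    proof -
      obtain a A where A: "convex_subgroup A" "x = a +o A" using x by (elim Q_cases)
      then have "x = Q_add (a +o {0}) (e x)"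
        by (simp add: neutral_Q Q_add_coset_subgroup convex_subgroup_0 zero_add)
      then show ?thesis using neutral_Q[OF convex_subgroup_0] Q_coset[OF convex_subgroup_0] by blast
    qed
    have b4: "\<exists>x\<in>(Q :: 'a set set). e x \<noteq> {0} \<and> e x \<noteq> UNIV"
    proof (intro bexI conjI)
      let ?L = "{x :: 'a. \<exists>n::nat. \<bar>x\<bar> \<le> of_nat n}"
      \<comment> \<open>The infinitely large \<open>w\<close> keeps the limited elements from being
        all of the field, while \<open>1\<close> keeps them from being \<open>{0}\<close>.\<close>
      obtain w :: 'a where w: "\<And>n::nat. of_nat n < w" using nonarchimedean by blast
      then have "w \<notin> ?L" using abs_ge_self[of w] by (auto simp: not_le intro: less_le_trans)
      moreover have "1 \<in> ?L" by (auto intro: exI[of _ 1])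
      ultimately show "e ?L \<noteq> {0}" "e ?L \<noteq> UNIV"
        unfolding neutral_Q_subgroup[OF convex_subgroup_limited] by (metis singletonD zero_neq_one, blast)
      show "?L \<in> Q" by (rule convex_subgroup_in_Q[OF convex_subgroup_limited])
    qed
    show "\<exists>m\<in>Q. \<exists>M\<in>Q. (\<forall>x\<in>Q. Q_add m x = x) \<and> (\<forall>x\<in>Q. Q_add (e x) M = M)
        \<and> (\<forall>x\<in>Q. \<exists>a\<in>Q. x = Q_add a (e x) \<and> e a = m) \<and> (\<exists>x\<in>(Q :: 'a set set). e x \<noteq> m \<and> e x \<noteq> M)"
      \<comment> \<open>The least and greatest neutral elements are the trivial subgroup and the
        whole field.\<close>
      by (rule bexI[OF bexI[OF _ UNIVQ] zeroQ]) (intro conjI ballI b1 b2 b3 b4)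
  next
    show "\<exists>u0\<in>Q. \<forall>x\<in>(Q :: 'a set set). Q_mult u0 x = x"
    proof (intro bexI ballI)
      fix x :: "'a set" assume "x \<in> Q"
      then obtain a A where A: "convex_subgroup A" and x_eq: "x = a +o A" by (elim Q_cases)
      have "a *o {0} = {0}" by (auto simp: elt_set_times_def)
      then show "Q_mult (1 +o {0}) x = x"
        using Q_mult_zeroless[OF convex_subgroup_0 A, of 1 a] by (simp add: x_eq add.commute[of A] zero_add)
    qed (rule Q_coset[OF convex_subgroup_0])
  next
    fix x y :: "'a set" assume xy: "x \<in> Q" "y \<in> Q" "x = e x" "y = e y" "Q_le x y \<and> x \<noteq> y"
    have "convex_subgroup w" if "w \<in> Q" "w = e w" for w :: "'a set"
      using that by (elim Q_cases) (simp add: neutral_Q)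
    then obtain A B where A: "convex_subgroup A" "x = A" and B: "convex_subgroup B" "y = B"
      using xy by blast
    \<comment> \<open>A positive \<open>b\<close> in \<open>B - A\<close> separates the two
      subgroups: its exact coset \<open>{b}\<close> lies above \<open>A\<close> because
      \<open>b\<close> dominates \<open>A\<close>, lies below \<open>B\<close> by membership, and is
      zeroless since \<open>b\<close> is nonzero.\<close>
    have "\<not> B \<subseteq> A" using xy A B Q_le_antisym Q_le_subset by metis
    then obtain b' where b': "b' \<in> B" "b' \<notin> A" by blast
    define b where "b = \<bar>b'\<bar>"
    have bB: "b \<in> B" using convex_subgroup_abs[OF B(1) b'(1)] by (simp add: b_def)
    have bA: "b \<notin> A" using convex_subgroup_abs[OF A(1), of b b'] b'(2) by (auto simp: b_def)
    have b0: "0 < b" using b' convex_subgroup_zero[OF A(1)] by (auto simp: b_def)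
    let ?z = "b +o {0}"
    have z: "?z = {b}" by (simp add: elt_set_plus_def)
    have "Q_le (0 +o A) ?z" by (rule Q_le_if_gap[OF A(1)]) (simp_all add: b0 bA convex_subgroup_0)
    moreover have "Q_le ?z B" using bB by (simp add: z Q_le_subset)
    moreover have "A \<noteq> ?z" "B \<noteq> ?z"
      using b0 convex_subgroup_zero[OF A(1)] convex_subgroup_zero[OF B(1)] by (auto simp: z)
    moreover have "e ?z = {0}" by (rule neutral_Q[OF convex_subgroup_0])
    ultimately show "\<exists>z\<in>Q. z \<noteq> e z \<and> (Q_le x z \<and> x \<noteq> z) \<and> (Q_le z y \<and> z \<noteq> y)"
      using b0 A B by (intro bexI[of _ ?z] Q_coset[OF convex_subgroup_0]) (auto simp: z)
  qed
qed

theorem theorem5p3: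
  assumes nonarchimedean: "\<exists>x::'a::linordered_field. \<forall>n::nat. of_nat n < x"
  shows "solid (Q :: 'a set set) Q_add Q_mult Q_le \<and>
    (\<forall>(a::'a) A. convex_subgroup A \<longrightarrow>
        neutral Q Q_add (a +o A) = A
      \<and> symmetric Q Q_add (a +o A) = (- a) +o A
      \<and> (\<not> convex_subgroup (a +o A) \<longrightarrow>
            neutral (zeroless Q Q_add) Q_mult (a +o A) = 1 +o ((\<lambda>x. x / a) ` A)
          \<and> symmetric (zeroless Q Q_add) Q_mult (a +o A) = (1 / a) +o ((\<lambda>x. x / a\<^sup>2) ` A)))"
  using solid_Q[OF nonarchimedean]
  by (simp add: neutral_Q symmetric_Q convex_subgroup_coset_iff neutral_Z symmetric_Z divide_image_eq_scale)

end
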